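(* For every $\alpha_0>0$ there is a constant $C=C(\alpha_0)>0$ such that the following holds. Let $n\geq 1$, $G=\mathbb{F}_2^n$, let $A\subset G$ have density $\alpha=|A|/|G|\geq \alpha_0$, and let $c\in(0,1)$. Then there is a set $A'\subset G$ such that $A'+A'\subset D_c(A)$ and \[ \mathbb{P}_G(A')\geq \exp\!\left(-C\,\frac{n}{\log c^{-1}}\right). \]
   Context: $\mathbb{P}_G$ denotes the normalized counting measure on $G$, so $\mathbb{P}_G(X)=|X|/|G|$. For $f,g:G\to\mathbb{R}$, the convolution is $f\ast g(x)=\int f(y)g(x-y)\,d\mathbb{P}_G(y)=\frac{1}{|G|}\sum_{y\in G}f(y)g(x-y)$. For $A\subset G$ of density $\alpha$ and $c\in[0,1]$, the popular difference set is $D_c(A)=\{x\in G: 1_A\ast 1_A(x)>c\alpha^2\}$. For sets $X,Y$, $X+Y=\{x+y:x\in X,y\in Y\}$. The paper states this as: if $A$ has density $\alpha=\Omega(1)$ then there is $A'$ with $A'+A'\subset D_c(A)$ and $\mathbb{P}_G(A')\geq\exp(-O(n/\log c^{-1}))$, the implied constant depending only on the lower bound for $\alpha$.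
   Formalization: The lower bound on P_G(A') is capped at the density: min(α, exp(−C n/log c⁻¹)). Uncapped it is false: for n=1, A={0}, D_c(A)={0} forces P_G(A') ≤ 1/2, while the bound tends to 1 as c→0. For log c⁻¹ ≤ n the original bound follows after enlarging C. *)

theory Defs
  imports Complex_Main "HOL-Library.Z2" "HOL-Library.Function_Algebras"
    "HOL-Library.Set_Algebras" "HOL-Library.Indicator_Function"
begin

(* The dimension has to be quantified under a constant that does not depend on it, so
   F_2^n is the set of bit sequences vanishing from index n on.  It is closed under the
   pointwise operations on functions. *)
definition F2_space :: "nat \<Rightarrow> (nat \<Rightarrow> bit) set" where
  "F2_space n = {x. \<forall>i\<ge>n. x i = 0}"

definition counting_prob :: "'a set \<Rightarrow> 'a set \<Rightarrow> real" where
  "counting_prob G X = real (card X) / real (card G)"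

(* In the following, G is (the carrier of) a finite subgroup of the ambient group. *)
definition group_conv ::
  "'a::ab_group_add set \<Rightarrow> ('a \<Rightarrow> real) \<Rightarrow> ('a \<Rightarrow> real) \<Rightarrow> 'a \<Rightarrow> real" where
  "group_conv G f g x = (1 / real (card G)) * (\<Sum>y\<in>G. f y * g (x - y))"

(* If A is a subgroup and 0 < c < 1, then the popular difference set is A itself, so a set A'
   with A' + A' inside it is never denser than A.  A lower bound for the density of A' that
   tends to 1 as c tends to 0 is therefore only possible when capped by the density of A. *)
definition popular_differences :: "'a::ab_group_add set \<Rightarrow> real \<Rightarrow> 'a set \<Rightarrow> 'a set" where
  "popular_differences G c A =
     {x \<in> G. group_conv G (indicat_real A) (indicat_real A) x > c * (counting_prob G A)\<^sup>2}"

end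

theory Submission imports Defs begin

text \<open>
  Dependent random choice: intersect \<open>F2_space n\<close> with \<open>m\<close> random translates of \<open>A\<close>.
  A point survives with probability \<open>\<alpha>\<^sup>m\<close>, whereas a pair with unpopular sum survives with
  probability at most \<open>(c * \<alpha>\<^sup>2)\<^sup>m\<close>.  For \<open>m\<close> a bit above \<open>n * ln 2 / ln (1 / c)\<close> the expected number
  of surviving unpopular pairs is at most half the expected number of surviving points, and one
  can delete a point from each such pair.  The translates are chosen one at a time, keeping track of
  the number of points minus a multiple of the number of unpopular pairs.  If \<open>c < 2\<^sup>-\<^sup>n\<close>, then a single
  representation already makes a sum popular and \<open>A' = A\<close> works.
\<close>

section \<open>The group F_2^n: size, characteristic 2, translations\<close>

lemma inj_on_support_F2_space: "inj_on (\<lambda>x. {i. x i = 1}) (F2_space n)"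
proof (rule inj_onI)
  fix x y :: "nat \<Rightarrow> bit" assume "{i. x i = 1} = {i. y i = 1}"
  then have "x i = 1 \<longleftrightarrow> y i = 1" for i by blast
  then show "x = y" by (intro ext) (metis bit_not_one_iff)
qed

lemma support_F2_space: "(\<lambda>x. {i. x i = 1}) ` F2_space n \<subseteq> Pow {..<n}"
  by (auto simp: F2_space_def) (metis bit.distinct(1) not_le_imp_less)

lemma finite_F2_space [simp]: "finite (F2_space n)"
  by (rule inj_on_finite[OF inj_on_support_F2_space support_F2_space]) simp

lemma card_F2_space_le: "card (F2_space n) \<le> 2 ^ n"
  using card_inj_on_le[OF inj_on_support_F2_space support_F2_space] by (simp add: card_Pow)

lemma zero_in_F2_space [simp]: "0 \<in> F2_space n"
  by (simp add: F2_space_def)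

lemma add_in_F2_space: "x \<in> F2_space n \<Longrightarrow> y \<in> F2_space n \<Longrightarrow> x + y \<in> F2_space n"
  by (simp add: F2_space_def)

lemma card_F2_space_pos: "0 < card (F2_space n)"
  by (metis card_gt_0_iff empty_iff finite_F2_space zero_in_F2_space)

lemma bit_seq_add_self [simp]: "x + x = (0 :: nat \<Rightarrow> bit)"
  by (simp add: fun_eq_iff)

lemma bit_seq_add_self_left [simp]: "x + (x + y) = (y :: nat \<Rightarrow> bit)"
  by (simp add: add.assoc[symmetric])

lemma bit_seq_diff: "x - y = (x + y :: nat \<Rightarrow> bit)"
  by (simp add: fun_eq_iff)

lemma bij_betw_add_F2_space:
  assumes "x \<in> F2_space n"
  shows "bij_betw ((+) x) (F2_space n) (F2_space n)"
  by (rule bij_betwI[where g = "(+) x"]) (auto intro: add_in_F2_space assms)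

lemma card_translate_F2_space:
  assumes "A \<subseteq> F2_space n" "x \<in> F2_space n"
  shows "card {z \<in> F2_space n. x + z \<in> A} = card A"
proof (rule bij_betw_same_card)
  show "bij_betw ((+) x) {z \<in> F2_space n. x + z \<in> A} A"
    by (rule bij_betwI[where g = "(+) x"]) (use assms in \<open>auto intro: add_in_F2_space\<close>)
qed

section \<open>Popularity of a sum in terms of translates\<close>

lemma group_conv_F2_space:
  assumes "x \<in> F2_space n" "y \<in> F2_space n"
  shows "group_conv (F2_space n) (indicat_real A) (indicat_real A) (x + y) =
    card {z \<in> F2_space n. x + z \<in> A \<and> y + z \<in> A} / card (F2_space n)"
proof -
  let ?G = "F2_space n"
  \<comment> \<open>Substitute w = x + z; in characteristic 2, x + y - w becomes y + z. So the
    convolution counts the translates of \<open>A\<close> by \<open>z\<close> that contain both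
    \<open>x\<close> and \<open>y\<close>.\<close>
  have "(\<Sum>w\<in>?G. indicat_real A w * indicat_real A (x + y - w)) =
      (\<Sum>z\<in>?G. indicat_real A (x + z) * indicat_real A (x + y - (x + z)))"
    by (rule sum.reindex_bij_betw[OF bij_betw_add_F2_space[OF assms(1)], symmetric])
  also have "\<dots> = (\<Sum>z\<in>?G. if x + z \<in> A \<and> y + z \<in> A then 1 else 0)"
    by (intro sum.cong) (auto simp: indicator_def bit_seq_diff ac_simps)
  also have "\<dots> = card {z \<in> ?G. x + z \<in> A \<and> y + z \<in> A}"
    by (simp add: sum.If_cases Int_def)
  finally show ?thesis by (simp add: group_conv_def)
qed

text \<open>Pairs are ordered and may be diagonal, so a set without such pairs has its whole sumset,
  sums x + x included, among the popular differences.\<close>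

definition unpopular_pairs ::
  "nat \<Rightarrow> real \<Rightarrow> (nat \<Rightarrow> bit) set \<Rightarrow> (nat \<Rightarrow> bit) set \<Rightarrow> ((nat \<Rightarrow> bit) \<times> (nat \<Rightarrow> bit)) set" where
  "unpopular_pairs n c A X =
     {(x, y) \<in> X \<times> X. x + y \<notin> popular_differences (F2_space n) c A}"

lemma finite_unpopular_pairs: "finite X \<Longrightarrow> finite (unpopular_pairs n c A X)"
  by (rule finite_subset[of _ "X \<times> X"]) (auto simp: unpopular_pairs_def)

text \<open>After division by the size of the group: both points of an unpopular pair lie in a
  random translate of \<open>A\<close> with probability at most c \<alpha>^2, where independence
  would suggest \<alpha>^2.\<close>

lemma card_translates_unpopular_pair:
  assumes "(x, y) \<in> unpopular_pairs n c A X" "X \<subseteq> F2_space n"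
  shows "card {z \<in> F2_space n. x + z \<in> A \<and> y + z \<in> A}
    \<le> c * (counting_prob (F2_space n) A)\<^sup>2 * card (F2_space n)"
proof -
  have "x \<in> F2_space n" "y \<in> F2_space n"
    using assms by (auto simp: unpopular_pairs_def)
  moreover from this have "x + y \<in> F2_space n" by (rule add_in_F2_space)
  ultimately show ?thesis
    using assms card_F2_space_pos[of n]
    by (simp add: unpopular_pairs_def popular_differences_def group_conv_F2_space
        not_less divide_le_eq)
qed

section \<open>Choosing translates by averaging\<close>

lemma sum_card_double_count:
  assumes "finite S" "finite T"
  shows "(\<Sum>s\<in>S. card {t \<in> T. P s t}) = (\<Sum>t\<in>T. card {s \<in> S. P s t})"
  by (rule sum_multicount_gen) (use assms in auto)

text \<open>Average over a uniform \<open>z\<close>: each point of \<open>X\<close> survives with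
  probability \<alpha>, each unpopular pair with probability at most c \<alpha>^2, and some
  \<open>z\<close> does at least as well as the mean. Factoring out \<alpha> leaves the same kind of
  expression for \<open>X\<close> with weight \<open>l * (c * \<alpha>)\<close>, ready for
  iteration.\<close>

lemma ex_good_translate:
  fixes n :: nat and A :: "(nat \<Rightarrow> bit) set" and c l :: real
  defines "G \<equiv> F2_space n" and "(\<alpha> :: real) \<equiv> counting_prob (F2_space n) A"
  assumes A: "A \<subseteq> G" and X: "X \<subseteq> G" and l: "l \<ge> 0"
  shows "\<exists>Y \<subseteq> X. real (card Y) - l * card (unpopular_pairs n c A Y) \<ge>
    \<alpha> * (card X - l * (c * \<alpha>) * card (unpopular_pairs n c A X))"
proof -
  define U where "U = unpopular_pairs n c A X"
  define Y where "Y z = {x \<in> X. x + z \<in> A}" for z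
  define N where "N = real (card G)"
  define f where "f z = real (card (Y z)) - l * card (unpopular_pairs n c A (Y z))" for z
  define v where "v = \<alpha> * (card X - l * (c * \<alpha>) * card U)"
  have fin: "finite G" "finite X" "finite U"
    using finite_subset[OF X] by (simp_all add: G_def U_def finite_unpopular_pairs)
  have N: "N > 0" by (simp add: N_def G_def card_F2_space_pos)
  have card_A: "real (card A) = \<alpha> * N"
    using N by (simp add: \<alpha>_def counting_prob_def flip: N_def G_def)
  \<comment> \<open>Popularity refers to \<open>A\<close> alone, so passing to a subset creates no
    unpopular pairs; it only keeps those with both points surviving.\<close>
  have UY: "unpopular_pairs n c A (Y z) = {p \<in> U. fst p + z \<in> A \<and> snd p + z \<in> A}" for z
    by (auto simp: unpopular_pairs_def U_def Y_def)
  have points: "(\<Sum>z\<in>G. card (Y z)) = card X * card A"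
  proof -
    have "(\<Sum>z\<in>G. card (Y z)) = (\<Sum>x\<in>X. card {z \<in> G. x + z \<in> A})"
      unfolding Y_def by (rule sum_card_double_count[OF fin(1,2)])
    also have "\<dots> = (\<Sum>x\<in>X. card A)"
      using A X by (intro sum.cong) (auto simp: G_def card_translate_F2_space)
    finally show ?thesis by simp
  qed
  have "real (\<Sum>z\<in>G. card (unpopular_pairs n c A (Y z))) =
      (\<Sum>p\<in>U. card {z \<in> G. fst p + z \<in> A \<and> snd p + z \<in> A})"
    unfolding UY by (subst sum_card_double_count[OF fin(1,3)]) simp
  also have "\<dots> \<le> (\<Sum>p\<in>U. c * \<alpha>\<^sup>2 * N)"
    unfolding N_def \<alpha>_def G_def U_def of_nat_sum
    using X by (intro sum_mono card_translates_unpopular_pair[where X = X]) (auto simp: G_def)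
  finally have pairs:
    "(\<Sum>z\<in>G. real (card (unpopular_pairs n c A (Y z)))) \<le> card U * (c * \<alpha>\<^sup>2 * N)" by simp
  have "(\<Sum>z\<in>G. \<alpha> * (card X - l * (c * \<alpha>) * card U)) =
      card X * (\<alpha> * N) - l * (card U * (c * \<alpha>\<^sup>2 * N))"
    by (simp add: N_def algebra_simps power2_eq_square)
  also have "\<dots> \<le> (\<Sum>z\<in>G. real (card (Y z)))
      - l * (\<Sum>z\<in>G. real (card (unpopular_pairs n c A (Y z))))"
    using mult_left_mono[OF pairs l] arg_cong[OF points, of real] by (simp add: card_A)
  also have "\<dots> = (\<Sum>z\<in>G. real (card (Y z)) - l * card (unpopular_pairs n c A (Y z)))"
    by (simp add: sum_subtractf sum_distrib_left)
  finally have "sum (\<lambda>z. v) G \<le> sum f G" unfolding v_def f_def .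
  moreover have "G \<noteq> {}" unfolding G_def using zero_in_F2_space by blast
  ultimately have "\<exists>z\<in>G. v \<le> f z"
    using sum_strict_mono[OF fin(1), of f "\<lambda>z. v"] by (meson leD not_le)
  then obtain z where "v \<le> f z" ..
  then show ?thesis
    unfolding U_def v_def f_def by (intro exI[of _ "Y z"]) (auto simp: Y_def)
qed

text \<open>One translate per induction step. The weight has to vary: the set left by the first
  \<open>m\<close> translates is chosen for the weight \<open>l * (c * \<alpha>)\<close> that the
  last translate calls for.\<close>

lemma ex_few_unpopular_pairs:
  fixes n :: nat and A :: "(nat \<Rightarrow> bit) set" and c l :: real
  defines "G \<equiv> F2_space n" and "(\<alpha> :: real) \<equiv> counting_prob (F2_space n) A"
  assumes A: "A \<subseteq> G" and c: "c \<ge> 0" and l: "l \<ge> 0"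
  shows "\<exists>X \<subseteq> G. real (card X) - l * card (unpopular_pairs n c A X) \<ge>
    \<alpha> ^ m * (card G - l * (c * \<alpha>) ^ m * card (unpopular_pairs n c A G))"
  using l
proof (induction m arbitrary: l)
  case 0
  then show ?case by auto
next
  case (Suc m)
  have \<alpha>: "\<alpha> \<ge> 0" by (simp add: \<alpha>_def counting_prob_def)
  with Suc.prems c have "l * (c * \<alpha>) \<ge> 0" by simp
  from Suc.IH[OF this] obtain X where X: "X \<subseteq> G"
    "real (card X) - l * (c * \<alpha>) * card (unpopular_pairs n c A X) \<ge>
      \<alpha> ^ m * (card G - l * (c * \<alpha>) * (c * \<alpha>) ^ m * card (unpopular_pairs n c A G))"
    by blast
  obtain Y where Y: "Y \<subseteq> X" "real (card Y) - l * card (unpopular_pairs n c A Y) \<ge>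
      \<alpha> * (card X - l * (c * \<alpha>) * card (unpopular_pairs n c A X))"
    using ex_good_translate[of A n X l c] A X(1) Suc.prems by (auto simp: G_def \<alpha>_def)
  have "\<alpha> ^ Suc m * (card G - l * (c * \<alpha>) ^ Suc m * card (unpopular_pairs n c A G)) =
    \<alpha> * (\<alpha> ^ m * (card G - l * (c * \<alpha>) * (c * \<alpha>) ^ m * card (unpopular_pairs n c A G)))"
    by (simp add: mult.assoc)
  also have "\<dots> \<le> \<alpha> * (card X - l * (c * \<alpha>) * card (unpopular_pairs n c A X))"
    by (rule mult_left_mono[OF X(2) \<alpha>])
  also note Y(2)
  finally show ?case using X(1) Y(1) by (intro exI[of _ Y]) auto
qed

section \<open>Deleting a point from each unpopular pair\<close>

lemma ex_popular_sumset:
  fixes n :: nat and A :: "(nat \<Rightarrow> bit) set" and c :: real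
  defines "G \<equiv> F2_space n" and "(\<alpha> :: real) \<equiv> counting_prob (F2_space n) A"
  assumes A: "A \<subseteq> G" and c: "c \<ge> 0" and m: "2 * 2 ^ n * c ^ m \<le> 1"
  shows "\<exists>A' \<subseteq> G. A' + A' \<subseteq> popular_differences G c A \<and> counting_prob G A' \<ge> \<alpha> ^ m / 2"
proof -
  define N where "N = real (card G)"
  have N: "N > 0" "N \<le> 2 ^ n"
    using card_F2_space_le[of n] by (auto simp: N_def G_def card_F2_space_pos
      dest: of_nat_mono[where 'a = real])
  have \<alpha>: "0 \<le> \<alpha>" "\<alpha> \<le> 1"
    using N A card_mono[OF finite_F2_space, of A n]
    by (auto simp: \<alpha>_def counting_prob_def G_def N_def)
  \<comment> \<open>The weight is 1 because each unpopular pair costs at most one point.\<close>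
  obtain X where X: "X \<subseteq> G" "real (card X) - card (unpopular_pairs n c A X) \<ge>
      \<alpha> ^ m * (N - (c * \<alpha>) ^ m * card (unpopular_pairs n c A G))"
    using ex_few_unpopular_pairs[of A n c 1 m] A c by (auto simp: G_def \<alpha>_def N_def)
  have finX: "finite X" using X(1) by (auto simp: G_def intro: finite_subset)
  define U where "U = unpopular_pairs n c A X"
  \<comment> \<open>An unpopular pair inside \<open>A'\<close> would belong to \<open>U\<close>, but
    its first point has been deleted.\<close>
  define A' where "A' = X - fst ` U"
  have "A' + A' \<subseteq> popular_differences G c A"
    by (force simp: A'_def U_def unpopular_pairs_def G_def elim!: set_plus_elim)
  moreover have "\<alpha> ^ m / 2 * N \<le> card A'"
  proof -
    have "card (unpopular_pairs n c A G) \<le> card (G \<times> G)"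
      by (rule card_mono) (auto simp: unpopular_pairs_def G_def)
    then have "real (card (unpopular_pairs n c A G)) \<le> N * N"
      by (auto simp: card_cartesian_product N_def dest: of_nat_mono[where 'a = real])
    moreover have "(c * \<alpha>) ^ m \<le> c ^ m"
      using c \<alpha> by (intro power_mono) (auto intro: mult_left_le)
    ultimately have "(c * \<alpha>) ^ m * card (unpopular_pairs n c A G) \<le> c ^ m * (N * N)"
      using c by (intro mult_mono) auto
    \<comment> \<open>One factor \<open>N\<close> is compared with the main term; the other is at
      most 2^n, and the hypothesis on \<open>m\<close> lets \<open>c ^ m\<close> absorb it with a
      factor 1/2 to spare.\<close>
    also have "\<dots> = (c ^ m * N) * N" by simp
    also have "\<dots> \<le> 1 / 2 * N"
    proof (rule mult_right_mono)
      have "c ^ m * N \<le> c ^ m * 2 ^ n"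
        using c N by (intro mult_left_mono) auto
      then show "c ^ m * N \<le> 1 / 2" using m by (simp add: mult_ac)
    qed (use N in simp)
    finally have "\<alpha> ^ m * (N / 2) \<le>
        \<alpha> ^ m * (N - (c * \<alpha>) ^ m * card (unpopular_pairs n c A G))"
      using \<alpha> by (intro mult_left_mono) auto
    also have "\<dots> \<le> real (card X) - card U" using X(2) by (simp add: U_def)
    also have "\<dots> \<le> real (card X) - card (fst ` U)"
      using finX by (simp add: card_image_le U_def finite_unpopular_pairs)
    also have "\<dots> \<le> card A'"
      using diff_card_le_card_Diff[of "fst ` U" X] finX
      by (simp add: A'_def U_def finite_unpopular_pairs)
    finally show ?thesis by simp
  qed
  then have "\<alpha> ^ m / 2 \<le> counting_prob G A'"
    using N(1) by (simp add: counting_prob_def N_def pos_le_divide_eq)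
  moreover have "A' \<subseteq> G" using X(1) by (auto simp: A'_def)
  ultimately show ?thesis by blast
qed

section \<open>Tiny thresholds\<close>

lemma sumset_popular_of_small_threshold:
  assumes A: "A \<subseteq> F2_space n" and c: "0 \<le> c" "c * 2 ^ n < 1"
  shows "A + A \<subseteq> popular_differences (F2_space n) c A"
proof
  fix w assume "w \<in> A + A"
  then obtain x y where w: "w = x + y" "x \<in> A" "y \<in> A" by (auto elim: set_plus_elim)
  let ?G = "F2_space n"
  let ?\<alpha> = "counting_prob ?G A"
  let ?R = "{z \<in> ?G. x + z \<in> A \<and> y + z \<in> A}"
  define N where "N = real (card ?G)"
  have xy: "x \<in> ?G" "y \<in> ?G" using A w by auto
  have N: "N > 0" "N \<le> 2 ^ n"
    using card_F2_space_le[of n] by (auto simp: N_def card_F2_space_pos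
      dest: of_nat_mono[where 'a = real])
  \<comment> \<open>The representation is z = x + y: adding it swaps \<open>x\<close> and
    \<open>y\<close>, which both lie in \<open>A\<close>.\<close>
  have "y + (x + y) = x" by (metis add.commute bit_seq_add_self_left)
  then have "x + y \<in> ?R" using xy w add_in_F2_space by simp
  then have "?R \<noteq> {}" by (rule ex_in_conv[THEN iffD1, OF exI])
  then have "card ?R > 0" by (subst card_gt_0_iff) simp
  have \<alpha>: "0 \<le> ?\<alpha>" "?\<alpha> \<le> 1"
    using N card_mono[OF finite_F2_space A] by (auto simp: counting_prob_def N_def)
  have "c * ?\<alpha>\<^sup>2 * N \<le> c * 1 * 2 ^ n"
    using c \<alpha> N by (intro mult_mono) (auto simp: power_le_one)
  also have "\<dots> < 1" using c by simp
  also have "\<dots> \<le> card ?R" using \<open>card ?R > 0\<close> by simp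
  finally have "c * ?\<alpha>\<^sup>2 < card ?R / N" using N(1) by (simp add: pos_less_divide_eq)
  then show "w \<in> popular_differences ?G c A"
    using xy by (simp add: popular_differences_def w group_conv_F2_space N_def add_in_F2_space)
qed

section \<open>Choosing the number of translates and the constant\<close>

theorem theorem1p7:
  fixes \<alpha>\<^sub>0 :: real
  assumes "\<alpha>\<^sub>0 > 0"
  shows "\<exists>C::real. C > 0 \<and>
    (\<forall>n::nat. \<forall>A. \<forall>c::real.
       n \<ge> 1 \<longrightarrow> A \<subseteq> F2_space n \<longrightarrow> counting_prob (F2_space n) A \<ge> \<alpha>\<^sub>0 \<longrightarrow> 0 < c \<longrightarrow> c < 1 \<longrightarrow>
       (\<exists>A'. A' \<subseteq> F2_space n \<and>
             A' + A' \<subseteq> popular_differences (F2_space n) c A \<and>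
             counting_prob (F2_space n) A' \<ge>
               min (counting_prob (F2_space n) A) (exp (- C * (real n / ln (1 / c))))))"
proof -
  \<comment> \<open>The absolute value keeps \<open>K\<close> nonnegative even for \<alpha>_0 > 1,
    and exp (-K) is at most \<alpha>_0 in every case.\<close>
  define K where "K = \<bar>ln \<alpha>\<^sub>0\<bar>"
  \<comment> \<open>With \<open>t\<close> as below, C n / L = t (3 K + ln 2): the term 3 K pays for
    \<alpha>^m with m \<le> 3 t, and ln 2 pays for the factor 1/2 lost by deletion.\<close>
  define C where "C = ln 2 * (3 * K + ln 2)"
  have K: "K \<ge> 0" by (simp add: K_def)
  have exp_K: "exp (- K) \<le> \<alpha>\<^sub>0"
    using assms by (simp add: K_def ln_ge_iff[symmetric] flip: ln_exp)
  have "C > 0" using K by (auto simp: C_def intro!: mult_pos_pos add_nonneg_pos)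
  moreover have "\<exists>A' \<subseteq> F2_space n. A' + A' \<subseteq> popular_differences (F2_space n) c A \<and>
      min (counting_prob (F2_space n) A) (exp (- C * (real n / ln (1 / c))))
        \<le> counting_prob (F2_space n) A'"
    if n: "n \<ge> 1" and A: "A \<subseteq> F2_space n" and \<alpha>: "counting_prob (F2_space n) A \<ge> \<alpha>\<^sub>0"
      and c: "0 < c" "c < 1" for n A and c :: real
  proof (cases "c * 2 ^ n < 1")
    case True
    \<comment> \<open>Here the minimum is bounded by the density of \<open>A\<close>; in the other
      case it is bounded by the exponential.\<close>
    then show ?thesis using sumset_popular_of_small_threshold[OF A] A c by (intro exI[of _ A]) auto
  next
    case False
    define L where "L = ln (1 / c)"
    define t where "t = n * ln 2 / L"
    \<comment> \<open>The extra 1 in n + 1 supplies the factor 2 in 2 * 2^n * c^m \<le> 1.\<close>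
    define m where "m = nat \<lceil>(n + 1) * ln 2 / L\<rceil>"
    have L: "L > 0" using c by (simp add: L_def)
    \<comment> \<open>Since \<open>c\<close> is not tiny, t \<ge> 1; this pays for rounding
      \<open>m\<close> up and, at the end, for the factor 1/2.\<close>
    have "1 / c \<le> 2 ^ n" using False c by (simp add: field_simps)
    then have "L \<le> ln (2 ^ n)" unfolding L_def using c by (subst ln_le_cancel_iff) auto
    then have t: "t \<ge> 1" using L by (simp add: t_def ln_realpow)
    have m_lower: "(n + 1) * ln 2 / L \<le> m" by (simp add: m_def real_nat_ceiling_ge)
    have "(n + 1) * ln 2 / L \<ge> 0" using L by simp
    then have "m \<le> (n + 1) * ln 2 / L + 1" unfolding m_def by linarith
    \<comment> \<open>n \<ge> 1 gives n + 1 \<le> 2 n.\<close>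
    also have "(n + 1) * ln 2 / L \<le> 2 * t"
      using n L by (auto simp: t_def intro!: divide_right_mono)
    finally have m_upper: "m \<le> 3 * t" using t by simp
    have "(n + 1) * ln 2 \<le> m * L" using m_lower L by (simp add: pos_divide_le_eq)
    then have "exp ((n + 1) * ln 2) \<le> exp (m * L)" by simp
    then have "2 ^ (n + 1) \<le> (1 / c) ^ m"
      using c unfolding exp_of_nat_mult L_def by simp
    then have "2 * 2 ^ n * c ^ m \<le> 1"
      using c by (simp add: power_one_over field_simps)
    from ex_popular_sumset[OF A _ this] c obtain A' where A':
      "A' \<subseteq> F2_space n" "A' + A' \<subseteq> popular_differences (F2_space n) c A"
      "counting_prob (F2_space n) A ^ m / 2 \<le> counting_prob (F2_space n) A'" by auto
    have "- C * (n / L) = - (3 * t) * K - t * ln 2"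
      by (simp add: C_def t_def algebra_simps add_divide_distrib)
    also have "\<dots> \<le> m * (- K) - ln 2"
      using mult_right_mono[OF m_upper K] mult_right_mono[OF t ln_ge_zero[of 2]] by linarith
    finally have "exp (- C * (n / L)) \<le> exp (m * (- K) - ln 2)" by simp
    also have "\<dots> = exp (- K) ^ m / 2" by (simp only: exp_diff exp_of_nat_mult) simp
    also have "\<dots> \<le> counting_prob (F2_space n) A ^ m / 2"
      using exp_K \<alpha> by (intro divide_right_mono power_mono) auto
    also note A'(3)
    finally show ?thesis using A' by (auto simp: L_def min_le_iff_disj)
  qed
  ultimately show ?thesis by (intro exI[of _ C]) (auto simp del: min_le_iff_disj)
qed

end
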